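(* For every graph $G$ and all integers $q,m \geq 2$, $D_q(D_m(G)) \cong D_{qm}(G)$.
   Context: For a graph $G$ with $V(G)=\{v_1,\dots,v_n\}$ and a positive integer $m$, the $m$-th shadow graph $D_m(G)$ has vertex set $\{v^i_j : i\in[m], j\in[n]\}$, with $v^i_j \sim v^k_l$ iff $v_j\sim v_l$ in $G$ (for any $i,k\in[m]$). *)

theory Defs
  imports "Graph_Theory.Graph_Theory"
begin

text \<open>
  A finite simple graph is a \<^locale>\<open>pair_graph\<close>: each edge \<open>{u, v}\<close> is represented by the
  two arcs \<open>(u, v)\<close> and \<open>(v, u)\<close>. The pair \<open>(i, v)\<close> stands for the \<open>i\<close>-th copy of the vertex \<open>v\<close>.
\<close>

definition shadow_graph :: "nat \<Rightarrow> 'a pair_pre_digraph \<Rightarrow> (nat \<times> 'a) pair_pre_digraph" where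
  "shadow_graph m G =
    \<lparr> pverts = {1..m} \<times> pverts G,
      parcs = {((i, u), (k, v)) | i u k v. i \<in> {1..m} \<and> k \<in> {1..m} \<and> (u, v) \<in> parcs G} \<rparr>"

lemma pair_graph_shadow_graph:
  assumes "pair_graph G"
  shows "pair_graph (shadow_graph m G)"
proof -
  interpret pair_graph G by (rule assms)
  have sym: "(v, u) \<in> parcs G" if "(u, v) \<in> parcs G" for u v
    using that pair_sym_arcs by (auto simp: symmetric_def dest: symD)
  have sub: "parcs (shadow_graph m G) \<subseteq> ({1..m} \<times> pverts G) \<times> ({1..m} \<times> pverts G)"
    by (auto simp: shadow_graph_def dest: in_arcsD1 in_arcsD2)
  show ?thesis
  proof
    show "finite (pverts (shadow_graph m G))"
      using pair_finite_verts by (simp add: shadow_graph_def)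
    show "finite (parcs (shadow_graph m G))"
      using pair_finite_verts by (intro finite_subset[OF sub]) auto
    show "symmetric (with_proj (shadow_graph m G))"
      by (auto simp: symmetric_def shadow_graph_def intro!: symI sym)
  qed (use sub pair_no_loops in \<open>auto simp: shadow_graph_def dest: in_arcsD1 in_arcsD2\<close>)
qed

end

theory Submission
  imports Defs
begin

text \<open>A vertex of \<open>shadow_graph q (shadow_graph m G)\<close> is a vertex
  \<open>v\<close> of \<open>G\<close> with a pair of copy labels \<open>(i, j)\<close>, and
  adjacency ignores the labels: only the underlying vertices in \<open>G\<close> matter. So any
  bijection \<open>b\<close> from the \<open>q * m\<close> label pairs onto
  \<open>{1..q * m}\<close> relabels the copies and gives an isomorphism fixing the
  \<open>G\<close>-component. \<open>digraph_iso_with_projI\<close> reduces the claim to the effect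
  of this map on vertices and arcs; \<open>in_parcs_shadow_graph_iff\<close> expresses that labels
  are free.\<close>

lemma digraph_iso_with_projI:
  assumes "pair_wf_digraph G"
    and inj: "inj_on f (pverts G)"
    and verts: "pverts H = f ` pverts G"
    and arcs: "parcs H = map_prod f f ` parcs G"
  shows "digraph_iso (with_proj G) (with_proj H)"
proof -
  interpret pair_wf_digraph G by (rule assms(1))
  \<comment> \<open>Arcs are vertex pairs with projections as tail and head, so \<open>f\<close>
    determines the arc map, and the projections stay the endpoint maps of the image.\<close>
  let ?hom = "\<lparr>iso_verts = f, iso_arcs = map_prod f f, iso_head = snd, iso_tail = fst\<rparr>"
  \<comment> \<open>Well-formedness puts arcs inside the square of the vertex set, where
    \<open>map_prod f f\<close> inherits injectivity from \<open>f\<close>.\<close>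
  have "parcs G \<subseteq> pverts G \<times> pverts G"
    by (auto dest: in_arcsD1 in_arcsD2)
  then have "inj_on (map_prod f f) (parcs G)"
    using map_prod_inj_on[OF inj inj] by (rule inj_on_subset[rotated])
  then have "pre_digraph.digraph_isomorphism (with_proj G) ?hom"
    using inj wf_digraph_axioms by (simp add: pre_digraph.digraph_isomorphism_def)
  moreover have "with_proj H = app_iso ?hom (with_proj G)"
    by (simp add: with_proj_def app_iso_def verts arcs)
  ultimately show ?thesis
    unfolding digraph_iso_def by blast
qed

lemma pverts_shadow_graph: "pverts (shadow_graph m G) = {1..m} \<times> pverts G"
  by (simp add: shadow_graph_def)

lemma in_parcs_shadow_graph_iff:
  "((i, u), (k, v)) \<in> parcs (shadow_graph m G) \<longleftrightarrow>
    i \<in> {1..m} \<and> k \<in> {1..m} \<and> (u, v) \<in> parcs G"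
  by (simp add: shadow_graph_def)

theorem theorem10:
  fixes G :: "'a pair_pre_digraph" and q m :: nat
  assumes "pair_graph G" and "q \<ge> 2" and "m \<ge> 2"
  shows "digraph_iso (with_proj (shadow_graph q (shadow_graph m G))) (with_proj (shadow_graph (q * m) G))"
proof -
  let ?D = "shadow_graph q (shadow_graph m G)"
  interpret D: pair_graph ?D
    by (intro pair_graph_shadow_graph assms(1))
  \<comment> \<open>Both sides have \<open>q * m\<close> elements; no explicit numbering of the
    pairs is needed.\<close>
  obtain b where b: "bij_betw b ({1..q} \<times> {1..m}) {1..q * m}"
    using finite_same_card_bij[of "{1..q} \<times> {1..m}" "{1..q * m}"] by auto
  note b_inj = bij_betw_imp_inj_on[OF b]
  \<comment> \<open>Oriented to rewrite \<open>{1..q * m}\<close> into the image of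
    \<open>b\<close>, so that membership yields a label pair.\<close>
  note b_image = bij_betw_imp_surj_on[OF b, symmetric]
  define f :: "nat \<times> nat \<times> 'a \<Rightarrow> nat \<times> 'a" where "f = (\<lambda>(i, j, v). (b (i, j), v))"
  have f: "f (i, j, v) = (b (i, j), v)" for i j v
    by (simp add: f_def)
  show ?thesis
  proof (rule digraph_iso_with_projI)
    show "pair_wf_digraph ?D"
      by (rule D.pair_wf_digraph_axioms)
    show "inj_on f (pverts ?D)"
    proof (rule inj_onI)
      fix x y assume "x \<in> pverts ?D" "y \<in> pverts ?D" "f x = f y"
      then show "x = y"
        \<comment> \<open>\<open>b\<close> is injective only on its domain, so the interval
          memberships of the labels are kept folded to match it.\<close>
        using inj_onD[OF b_inj]
        by (cases x; cases y) (simp add: pverts_shadow_graph f del: atLeastAtMost_iff, blast)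
    qed
    show "pverts (shadow_graph (q * m) G) = f ` pverts ?D"
    proof -
      have "f ` ({1..q} \<times> {1..m} \<times> pverts G) = b ` ({1..q} \<times> {1..m}) \<times> pverts G"
        by (force simp: f simp del: atLeastAtMost_iff)
      then show ?thesis
        by (simp only: pverts_shadow_graph b_image)
    qed
    show "parcs (shadow_graph (q * m) G) = map_prod f f ` parcs ?D"
    proof (intro subset_antisym subsetI)
      fix e assume e: "e \<in> parcs (shadow_graph (q * m) G)"
      obtain k u l v where e_eq: "e = ((k, u), (l, v))"
        by (metis surj_pair)
      have kl: "k \<in> b ` ({1..q} \<times> {1..m})" "l \<in> b ` ({1..q} \<times> {1..m})" "(u, v) \<in> parcs G"
        using e unfolding e_eq in_parcs_shadow_graph_iff b_image by blast+
      \<comment> \<open>The two endpoint labels are decoded independently, since an arc imposes no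
        relation between them.\<close>
      obtain i j where k: "i \<in> {1..q}" "j \<in> {1..m}" "k = b (i, j)"
        using kl(1) by blast
      obtain i' j' where l: "i' \<in> {1..q}" "j' \<in> {1..m}" "l = b (i', j')"
        using kl(2) by blast
      have "((i, j, u), (i', j', v)) \<in> parcs ?D"
        unfolding in_parcs_shadow_graph_iff using k l kl(3) by blast
      moreover have "e = map_prod f f ((i, j, u), (i', j', v))"
        by (simp add: e_eq f k l)
      ultimately show "e \<in> map_prod f f ` parcs ?D"
        by (rule rev_image_eqI)
    next
      fix e assume "e \<in> map_prod f f ` parcs ?D"
      then obtain a where a: "e = map_prod f f a" "a \<in> parcs ?D"
        by (rule imageE)
      obtain i j u i' j' v where a_eq: "a = ((i, j, u), (i', j', v))"
        by (metis surj_pair)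
      have e: "e = ((b (i, j), u), (b (i', j'), v))"
        by (simp add: a(1) a_eq f)
      show "e \<in> parcs (shadow_graph (q * m) G)"
        using a(2) unfolding a_eq e in_parcs_shadow_graph_iff b_image by blast
    qed
  qed
qed

end
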